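(* For any positive integer $k$, $$\dim(H_k) = k+1 \text{ and } \mathrm{edim}(H_k) = k + 2^k = n-1,$$ where $n=|V(H_k)|=k+2^k+1$.
   Context: For a positive integer $k$, $F_k$ is the graph on vertex set $A \cup B$, where $B = \{b_1, \ldots, b_k\}$ and $A = \{ a_S \mid S \subseteq B \}$; all pairs of distinct vertices of $B$ are adjacent, all pairs of distinct vertices of $A$ are adjacent, and $b_i\in B$, $a_S\in A$ are adjacent if and only if $b_i \in S$. $H_k = F_k + K_1$, i.e., $F_k$ with one extra vertex $t$ joined to all vertices of $F_k$. $\dim(G)$ is the vertex metric dimension (minimum size of a vertex set distinguishing all pairs of vertices by distances); for an edge $e=xy$ and vertex $v$, $d(e,v)=\min\{d(x,v),d(y,v)\}$, and $\mathrm{edim}(G)$ is the minimum size of a vertex set distinguishing all pairs of edges by such distances. *)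

theory Defs
  imports Main "HOL-Library.Extended_Nat"
begin

record 'a ugraph =
  verts :: "'a set"
  edges :: "'a set set"

definition simple_graph :: "'a ugraph \<Rightarrow> bool" where
  "simple_graph G \<longleftrightarrow>
     finite (verts G) \<and> (\<forall>e \<in> edges G. e \<subseteq> verts G \<and> card e = 2)"

definition walk_betw :: "'a ugraph \<Rightarrow> 'a \<Rightarrow> 'a list \<Rightarrow> 'a \<Rightarrow> bool" where
  "walk_betw G u p v \<longleftrightarrow>
     p \<noteq> [] \<and> hd p = u \<and> last p = v \<and> set p \<subseteq> verts G \<and>
     successively (\<lambda>x y. {x, y} \<in> edges G) p"

text \<open>A walk is given by its list of vertices, so its length is one less than that of the list.
  Vertices in different components have distance \<open>\<infinity>\<close>.\<close>

definition gdist :: "'a ugraph \<Rightarrow> 'a \<Rightarrow> 'a \<Rightarrow> enat" where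
  "gdist G u v = (INF p \<in> {p. walk_betw G u p v}. enat (length p - 1))"

definition edge_dist :: "'a ugraph \<Rightarrow> 'a set \<Rightarrow> 'a \<Rightarrow> enat" where
  "edge_dist G e v = (MIN x \<in> e. gdist G x v)"

definition metric_generator :: "'a ugraph \<Rightarrow> 'a set \<Rightarrow> bool" where
  "metric_generator G W \<longleftrightarrow> W \<subseteq> verts G \<and>
     (\<forall>x \<in> verts G. \<forall>y \<in> verts G. x \<noteq> y \<longrightarrow> (\<exists>w \<in> W. gdist G x w \<noteq> gdist G y w))"

definition edge_metric_generator :: "'a ugraph \<Rightarrow> 'a set \<Rightarrow> bool" where
  "edge_metric_generator G W \<longleftrightarrow> W \<subseteq> verts G \<and>
     (\<forall>e \<in> edges G. \<forall>f \<in> edges G. e \<noteq> f \<longrightarrow> (\<exists>w \<in> W. edge_dist G e w \<noteq> edge_dist G f w))"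

text \<open>In a finite simple graph the whole vertex set is a generator of either kind, so both
  minima below are attained.\<close>

definition metric_dim :: "'a ugraph \<Rightarrow> nat" where
  "metric_dim G = (LEAST m. \<exists>W. finite W \<and> metric_generator G W \<and> card W = m)"

definition edge_metric_dim :: "'a ugraph \<Rightarrow> nat" where
  "edge_metric_dim G = (LEAST m. \<exists>W. finite W \<and> edge_metric_generator G W \<and> card W = m)"

definition complete_graph :: "'a set \<Rightarrow> 'a ugraph" where
  "complete_graph V = \<lparr>verts = V, edges = {{u, v} | u v. u \<in> V \<and> v \<in> V \<and> u \<noteq> v}\<rparr>"

definition graph_join :: "'a ugraph \<Rightarrow> 'b ugraph \<Rightarrow> ('a + 'b) ugraph" where
  "graph_join G H =
     \<lparr>verts = verts G <+> verts H,
      edges = (`) Inl ` edges G \<union> (`) Inr ` edges H \<union>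
        {{Inl u, Inr v} | u v. u \<in> verts G \<and> v \<in> verts H}\<rparr>"

text \<open>\<open>BV i\<close> is $b_i$, and \<open>AV S\<close> is $a_{S'}$ for $S' = \{b_i \mid i \in S\}$: subsets of $B$ are
  represented by the corresponding sets of indices.\<close>

datatype fvertex = BV nat | AV "nat set"

definition F_graph :: "nat \<Rightarrow> fvertex ugraph" where
  "F_graph k =
     \<lparr>verts = AV ` Pow {1..k} \<union> BV ` {1..k},
      edges = {{BV i, BV j} | i j. i \<in> {1..k} \<and> j \<in> {1..k} \<and> i \<noteq> j} \<union>
        {{AV S, AV T} | S T. S \<subseteq> {1..k} \<and> T \<subseteq> {1..k} \<and> S \<noteq> T} \<union>
        {{BV i, AV S} | i S. S \<subseteq> {1..k} \<and> i \<in> S}\<rparr>"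

definition H_graph :: "nat \<Rightarrow> (fvertex + unit) ugraph" where
  "H_graph k = graph_join (F_graph k) (complete_graph {()})"

lemma simple_graph_F_graph: "simple_graph (F_graph k)"
  unfolding simple_graph_def F_graph_def by (auto simp: card_insert_if)

lemma simple_graph_H_graph: "simple_graph (H_graph k)"
proof -
  have "card (Inl ` e :: (fvertex + unit) set) = card e" for e :: "fvertex set"
    by (simp add: card_image)
  then show ?thesis
    using simple_graph_F_graph[of k]
    unfolding simple_graph_def H_graph_def graph_join_def complete_graph_def
    by auto
qed

end

theory Submission imports Defs
begin

text \<open>Every distance in \<open>H_graph k\<close> is at most 2, so a metric generator of size \<open>m\<close> leaves at most
  \<open>2 ^ m\<close> vertices outside itself; this excludes \<open>m \<le> k\<close>, while \<open>B \<union> {t}\<close> is a generator of size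
  \<open>k + 1\<close>. For edges, both \<open>t\<close> and the vertex \<open>a\<^sub>B\<close> are adjacent to all others. An edge containing
  such a vertex is at distance 0 from its ends and at distance 1 from everything else. Hence for any
  two vertices \<open>u\<close>, \<open>v\<close> there is an \<open>x\<close> for which the edges \<open>xu\<close> and \<open>xv\<close> are distinguished by
  \<open>u\<close> and \<open>v\<close> only, so an edge metric generator misses at most one vertex. Conversely, all vertices
  but one suffice, since the trace of an edge on them determines the edge.\<close>

section \<open>Distances 0 and 1\<close>

lemma gdist_le:
  assumes "walk_betw G u p v"
  shows "gdist G u v \<le> enat (length p - 1)"
  unfolding gdist_def by (rule INF_lower) (use assms in simp)

lemma gdist_attained:
  assumes "gdist G u v = enat n"
  obtains p where "walk_betw G u p v" "length p - 1 = n"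
proof -
  let ?D = "(\<lambda>p. enat (length p - 1)) ` {p. walk_betw G u p v}"
  \<comment> \<open>Without walks the infimum would be \<open>\<infinity>\<close>. Over a nonempty
    set it is attained, because \<open>enat\<close> is well-ordered.\<close>
  have "?D \<noteq> {}"
  proof
    assume "?D = {}"
    then have "gdist G u v = \<infinity>"
      unfolding gdist_def by (simp add: top_enat_def)
    with assms show False by simp
  qed
  then obtain d where "d \<in> ?D"
    by blast
  then have "Inf ?D \<in> ?D"
    by (rule wellorder_InfI)
  then have "enat n \<in> ?D"
    using assms unfolding gdist_def by simp
  then show ?thesis
    using that by auto
qed

lemma gdist_eq_0_iff:
  assumes "u \<in> verts G"
  shows "gdist G u v = 0 \<longleftrightarrow> u = v"
proof
  assume "gdist G u v = 0"
  then obtain p where "walk_betw G u p v" "length p - 1 = 0"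
    using gdist_attained by (metis zero_enat_def)
  then show "u = v"
    unfolding walk_betw_def by (cases p) auto
next
  assume "u = v"
  then have "walk_betw G u [u] v"
    using assms unfolding walk_betw_def by simp
  then show "gdist G u v = 0"
    using gdist_le[of G u "[u]" v] by (simp flip: zero_enat_def)
qed

lemma gdist_eq_1_iff:
  assumes "u \<in> verts G" "v \<in> verts G" "u \<noteq> v"
  shows "gdist G u v = 1 \<longleftrightarrow> {u, v} \<in> edges G"
proof
  assume "gdist G u v = 1"
  then obtain p where p: "walk_betw G u p v" "length p - 1 = 1"
    using gdist_attained by (metis one_enat_def)
  then obtain x y where "p = [x, y]"
    by (cases p; cases "tl p") auto
  then show "{u, v} \<in> edges G"
    using p unfolding walk_betw_def by auto
next
  assume "{u, v} \<in> edges G"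
  then have "walk_betw G u [u, v] v"
    using assms unfolding walk_betw_def by simp
  then have "gdist G u v \<le> 1"
    using gdist_le[of G u "[u, v]" v] by (simp add: one_enat_def)
  moreover have "gdist G u v \<noteq> 0"
    using assms by (simp add: gdist_eq_0_iff)
  ultimately show "gdist G u v = 1"
    by (cases "gdist G u v") (auto simp: one_enat_def zero_enat_def)
qed

section \<open>Universal vertices, and counting for metric generators\<close>

definition dominating :: "'a ugraph \<Rightarrow> 'a \<Rightarrow> bool" where
  "dominating G d \<longleftrightarrow> d \<in> verts G \<and> (\<forall>v \<in> verts G. v \<noteq> d \<longrightarrow> {d, v} \<in> edges G)"

lemma dominating_gdist_le_2:
  assumes "dominating G d" "u \<in> verts G" "v \<in> verts G"
  shows "gdist G u v \<le> 2"
proof (cases "u = d \<or> v = d")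
  case True
  then have "u = v \<or> {u, v} \<in> edges G"
    using assms unfolding dominating_def by (auto simp: insert_commute)
  then have "gdist G u v = 0 \<or> gdist G u v = 1"
    using assms by (metis gdist_eq_0_iff gdist_eq_1_iff)
  then show ?thesis
    by (auto simp: one_enat_def zero_enat_def numeral_eq_enat)
next
  case False
  then have "walk_betw G u [u, d, v] v"
    using assms unfolding walk_betw_def dominating_def by (auto simp: insert_commute)
  from gdist_le[OF this] show ?thesis
    by (simp add: numeral_eq_enat eval_nat_numeral)
qed

text \<open>Vertices outside \<open>W\<close> see each member of \<open>W\<close> at distance 1 or
  2. Hence the set of neighbours in \<open>W\<close> determines such a vertex, which injects
  \<open>verts G - W\<close> into \<open>Pow W\<close>.\<close>

lemma metric_generator_card_bound:
  assumes fin: "finite (verts G)" and W: "metric_generator G W"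
    and diam: "\<And>u v. u \<in> verts G \<Longrightarrow> v \<in> verts G \<Longrightarrow> gdist G u v \<le> 2"
  shows "card (verts G) \<le> card W + 2 ^ card W"
proof -
  have WV: "W \<subseteq> verts G"
    using W unfolding metric_generator_def by blast
  have finW: "finite W"
    using WV fin by (rule finite_subset)
  let ?N = "\<lambda>x. {w \<in> W. gdist G x w = 1}"
  have dist: "gdist G x w = 1 \<or> gdist G x w = 2" if "x \<in> verts G - W" "w \<in> W" for x w
  proof -
    have "gdist G x w \<le> 2" "gdist G x w \<noteq> 0"
      using diam that WV by (auto simp: gdist_eq_0_iff)
    then show ?thesis
      by (cases "gdist G x w") (auto simp: one_enat_def zero_enat_def numeral_eq_enat)
  qed
  have "inj_on ?N (verts G - W)"
  proof (rule inj_onI, rule ccontr)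
    fix x y
    assume xy: "x \<in> verts G - W" "y \<in> verts G - W" "?N x = ?N y" "x \<noteq> y"
    then obtain w where w: "w \<in> W" "gdist G x w \<noteq> gdist G y w"
      using W unfolding metric_generator_def by blast
    have "gdist G x w = 1 \<longleftrightarrow> gdist G y w = 1"
      using xy(3) w(1) by blast
    then show False
      using w dist xy(1,2) by metis
  qed
  then have "card (verts G - W) \<le> card (Pow W)"
    by (rule card_inj_on_le) (use finW in auto)
  then show ?thesis
    using WV finW by (simp add: card_Pow card_Diff_subset)
qed

section \<open>Edge metric generators\<close>

lemma edge_dist_eq_0_iff:
  assumes "simple_graph G" "e \<in> edges G"
  shows "edge_dist G e w = 0 \<longleftrightarrow> w \<in> e"
proof -
  have e: "e \<subseteq> verts G" "finite e" "e \<noteq> {}"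
    using assms unfolding simple_graph_def by (auto intro: finite_subset)
  have "edge_dist G e w = 0 \<longleftrightarrow> (\<exists>x \<in> e. gdist G x w = 0)"
    unfolding edge_dist_def using e by (subst Min_eq_iff) auto
  also have "\<dots> \<longleftrightarrow> w \<in> e"
    using e(1) gdist_eq_0_iff by (metis subsetD)
  finally show ?thesis .
qed

text \<open>The end \<open>d\<close> bounds the distance by 1, and the value 0 occurs only at the
  ends of the edge.\<close>

lemma edge_dist_dominating:
  assumes G: "simple_graph G" and e: "e \<in> edges G" and d: "d \<in> e" "dominating G d"
    and w: "w \<in> verts G" "w \<notin> e"
  shows "edge_dist G e w = 1"
proof -
  have "finite e"
    using G e unfolding simple_graph_def by (auto intro: finite_subset)
  moreover have "gdist G d w = 1"
    using d w unfolding dominating_def by (subst gdist_eq_1_iff) auto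
  ultimately have "edge_dist G e w \<le> 1"
    unfolding edge_dist_def using d(1) by (metis Min_le finite_imageI imageI)
  moreover have "edge_dist G e w \<noteq> 0"
    using G e w by (simp add: edge_dist_eq_0_iff)
  ultimately show ?thesis
    by (cases "edge_dist G e w") (auto simp: one_enat_def zero_enat_def)
qed

text \<open>A vertex on exactly one of two edges has distance 0 to that edge only, so it suffices to
  find one other than \<open>t\<close>.\<close>

lemma edge_metric_generator_co_singleton:
  assumes G: "simple_graph G"
  shows "edge_metric_generator G (verts G - {t})"
  unfolding edge_metric_generator_def
proof (intro conjI ballI impI)
  fix e f
  assume ef: "e \<in> edges G" "f \<in> edges G" "e \<noteq> f"
  have sub: "e \<subseteq> verts G" "f \<subseteq> verts G" and card: "card e = 2" "card f = 2"
    using G ef unfolding simple_graph_def by auto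
  have fin: "finite e" "finite f"
    using card by (auto intro: card_ge_0_finite)
  have "e - {t} \<noteq> f - {t}"
  proof
    assume eq: "e - {t} = f - {t}"
    \<comment> \<open>Since all edges have two ends, the size of the trace reveals whether
      \<open>t\<close> was removed; equal traces thus come from equal edges.\<close>
    have "card (e - {t}) = (if t \<in> e then 1 else 2)" "card (f - {t}) = (if t \<in> f then 1 else 2)"
      using card fin by auto
    then have "(if t \<in> e then 1 else 2 :: nat) = (if t \<in> f then 1 else 2)"
      by (simp only: eq)
    then have "t \<in> e \<longleftrightarrow> t \<in> f"
      by (simp split: if_splits)
    then show False
      using eq ef(3) by blast
  qed
  then obtain w where "w \<noteq> t" "w \<in> e \<longleftrightarrow> w \<notin> f"
    by blast
  then show "\<exists>w \<in> verts G - {t}. edge_dist G e w \<noteq> edge_dist G f w"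
    using sub edge_dist_eq_0_iff[OF G ef(1), of w] edge_dist_eq_0_iff[OF G ef(2), of w]
    by (intro bexI[of _ w]) auto
qed auto

lemma card_edge_metric_generator_ge:
  assumes G: "simple_graph G" and W: "edge_metric_generator G W"
    and st: "dominating G s" "dominating G t" "s \<noteq> t" and three: "card (verts G) \<ge> 3"
  shows "card (verts G) - 1 \<le> card W"
proof (rule ccontr)
  assume less: "\<not> ?thesis"
  have fin: "finite (verts G)" and WV: "W \<subseteq> verts G"
    using G W unfolding simple_graph_def edge_metric_generator_def by auto
  then have "card (verts G - W) \<ge> 2"
    using less by (subst card_Diff_subset) (auto intro: finite_subset)
  then obtain D where "D \<subseteq> verts G - W" "card D = 2"
    using obtain_subset_with_card_n by metis
  then obtain u v where uv: "u \<in> verts G - W" "v \<in> verts G - W" "u \<noteq> v"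
    by (auto simp: card_2_iff)
  \<comment> \<open>The disjunction puts a dominating vertex on both \<open>{x, u}\<close> and
    \<open>{x, v}\<close>. Usually \<open>x\<close> is \<open>s\<close> or \<open>t\<close>; if
    these are the two missed vertices, any third vertex serves.\<close>
  obtain x where x: "x \<in> verts G" "x \<noteq> u" "x \<noteq> v"
    and dom: "dominating G x \<or> dominating G u \<and> dominating G v"
  proof (cases "{u, v} = {s, t}")
    case True
    have "\<not> verts G \<subseteq> {u, v}"
      using card_mono[of "{u, v}" "verts G"] three uv(3) by auto
    moreover have "dominating G u \<and> dominating G v"
      using True st by (auto simp: doubleton_eq_iff)
    ultimately show ?thesis
      using that by blast
  next
    case False
    then have "s \<notin> {u, v} \<or> t \<notin> {u, v}"
      using st(3) by blast
    then show ?thesis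
      using that st unfolding dominating_def by auto
  qed
  have edges: "{x, u} \<in> edges G" "{x, v} \<in> edges G"
    using dom x uv unfolding dominating_def by (auto simp: insert_commute)
  \<comment> \<open>Both distances are 0 for \<open>w = x\<close>. Any other \<open>w\<close> in
    \<open>W\<close> avoids \<open>u\<close> and \<open>v\<close>, so it lies on neither edge and
    both distances are 1.\<close>
  have "edge_dist G {x, u} w = edge_dist G {x, v} w" if "w \<in> W" for w
  proof (cases "w = x")
    case True
    then have "edge_dist G {x, u} w = 0" "edge_dist G {x, v} w = 0"
      using edges by (simp_all add: edge_dist_eq_0_iff[OF G])
    then show ?thesis
      by simp
  next
    case False
    then have "w \<in> verts G" "w \<notin> {x, u}" "w \<notin> {x, v}"
      using that WV uv by auto
    then show ?thesis
      using dom edges edge_dist_dominating[OF G] by (metis insertCI)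
  qed
  moreover have "{x, u} \<noteq> {x, v}"
    using uv(3) by (auto simp: doubleton_eq_iff)
  moreover have "\<exists>w \<in> W. edge_dist G {x, u} w \<noteq> edge_dist G {x, v} w" if "{x, u} \<noteq> {x, v}"
    using W edges that unfolding edge_metric_generator_def by metis
  ultimately show False
    by blast
qed

lemma edge_metric_dim_two_dominating:
  assumes G: "simple_graph G"
    and st: "dominating G s" "dominating G t" "s \<noteq> t" and three: "card (verts G) \<ge> 3"
  shows "edge_metric_dim G = card (verts G) - 1"
  unfolding edge_metric_dim_def
proof (rule Least_equality)
  have "finite (verts G)" "t \<in> verts G"
    using G st unfolding simple_graph_def dominating_def by auto
  then show "\<exists>W. finite W \<and> edge_metric_generator G W \<and> card W = card (verts G) - 1"
    using edge_metric_generator_co_singleton[OF G, of t]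
    by (intro exI[of _ "verts G - {t}"]) auto
next
  fix m
  assume "\<exists>W. finite W \<and> edge_metric_generator G W \<and> card W = m"
  then show "card (verts G) - 1 \<le> m"
    using card_edge_metric_generator_ge[OF G _ st three] by blast
qed

section \<open>Vertices, edges and dominating vertices of \<open>H_graph k\<close>\<close>

lemma verts_H_graph:
  "verts (H_graph k) = Inl ` AV ` Pow {1..k} \<union> Inl ` BV ` {1..k} \<union> {Inr ()}"
  unfolding H_graph_def graph_join_def F_graph_def complete_graph_def
  by (simp add: Plus_def image_Un)

lemma Inl_image_edge_H_graph: "Inl ` e \<in> edges (H_graph k) \<longleftrightarrow> e \<in> edges (F_graph k)"
proof -
  \<comment> \<open>This excludes the joining edges; the one-vertex complete graph contributes
    none.\<close>
  have "Inl ` e \<noteq> {Inl u, Inr v}" for u :: fvertex and v :: unit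
    by blast
  moreover have "inj ((`) Inl :: fvertex set \<Rightarrow> (fvertex + unit) set)"
    by (rule inj_on_image) simp
  ultimately show ?thesis
    unfolding H_graph_def graph_join_def complete_graph_def by (simp add: inj_image_mem_iff)
qed

lemma card_verts_H_graph: "card (verts (H_graph k)) = k + 2 ^ k + 1"
proof -
  have "card (Inl ` AV ` Pow {1..k} :: (fvertex + unit) set) = 2 ^ k"
    by (simp add: card_image inj_on_def card_Pow)
  moreover have "card (Inl ` BV ` {1..k} :: (fvertex + unit) set) = k"
    by (simp add: card_image inj_on_def)
  ultimately have "card (Inl ` AV ` Pow {1..k} \<union> Inl ` BV ` {1..k} :: (fvertex + unit) set) = 2 ^ k + k"
    by (subst card_Un_disjoint) auto
  then show ?thesis
    unfolding verts_H_graph by (subst card_Un_disjoint) auto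
qed

lemma edge_AV_BV_H_graph:
  "{Inl (AV S), Inl (BV i)} \<in> edges (H_graph k) \<longleftrightarrow> S \<subseteq> {1..k} \<and> i \<in> S"
proof -
  have "{Inl (AV S), Inl (BV i)} = (Inl ` {BV i, AV S} :: (fvertex + unit) set)"
    by auto
  then have "{Inl (AV S), Inl (BV i)} \<in> edges (H_graph k) \<longleftrightarrow> {BV i, AV S} \<in> edges (F_graph k)"
    by (simp only: Inl_image_edge_H_graph)
  also have "\<dots> \<longleftrightarrow> S \<subseteq> {1..k} \<and> i \<in> S"
    unfolding F_graph_def by (auto simp: doubleton_eq_iff)
  finally show ?thesis .
qed

lemma dominating_Inr_H_graph: "dominating (H_graph k) (Inr ())"
  unfolding dominating_def H_graph_def graph_join_def complete_graph_def
  by (auto simp: doubleton_eq_iff)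

text \<open>This vertex is \<open>a_B\<close>: its index set contains every \<open>i\<close>, the
  vertices of \<open>A\<close> form a clique, and the join supplies the edge to
  \<open>Inr ()\<close>.\<close>

lemma dominating_AV_H_graph: "dominating (H_graph k) (Inl (AV {1..k}))"
  unfolding dominating_def
proof (intro conjI ballI impI)
  fix v
  assume v: "v \<in> verts (H_graph k)" "v \<noteq> Inl (AV {1..k})"
  consider (A) S where "v = Inl (AV S)" "S \<subseteq> {1..k}" | (B) i where "v = Inl (BV i)" "i \<in> {1..k}"
    | (t) "v = Inr ()"
    using v(1) unfolding verts_H_graph by auto
  then show "{Inl (AV {1..k}), v} \<in> edges (H_graph k)"
  proof cases
    case A
    then have "{AV {1..k}, AV S} \<in> edges (F_graph k)"
      using v(2) unfolding F_graph_def by auto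
    then have "Inl ` {AV {1..k}, AV S} \<in> edges (H_graph k)"
      by (simp only: Inl_image_edge_H_graph)
    then show ?thesis
      using A by simp
  next
    case B
    then show ?thesis
      by (simp add: edge_AV_BV_H_graph)
  next
    case t
    then show ?thesis
      unfolding H_graph_def graph_join_def F_graph_def complete_graph_def by auto
  qed
qed (simp add: verts_H_graph)

section \<open>The two dimensions of \<open>H_graph k\<close>\<close>

lemma metric_generator_H_graph:
  "metric_generator (H_graph k) (insert (Inr ()) (Inl ` BV ` {1..k}))" (is "metric_generator ?H ?W")
  unfolding metric_generator_def
proof (intro conjI ballI impI)
  show WV: "?W \<subseteq> verts ?H"
    unfolding verts_H_graph by auto
  fix x y
  assume xy: "x \<in> verts ?H" "y \<in> verts ?H" "x \<noteq> y"
  show "\<exists>w \<in> ?W. gdist ?H x w \<noteq> gdist ?H y w"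
  proof (cases "x \<in> ?W \<or> y \<in> ?W")
    \<comment> \<open>A vertex in the generator distinguishes itself from all others by distance
      0.\<close>
    case True
    then show ?thesis
      using xy by (metis gdist_eq_0_iff)
  next
    case False
    then obtain S T where ST: "x = Inl (AV S)" "y = Inl (AV T)" "S \<subseteq> {1..k}" "T \<subseteq> {1..k}"
      using xy(1,2) unfolding verts_H_graph by auto
    \<comment> \<open>Any index in the symmetric difference works: \<open>BV i\<close> is adjacent
      to exactly one of the two vertices.\<close>
    then obtain i where i: "i \<in> {1..k}" "i \<in> S \<longleftrightarrow> i \<notin> T"
      using xy(3) by blast
    let ?b = "Inl (BV i) :: fvertex + unit"
    have b: "?b \<in> ?W"
      using i(1) by blast
    then have "?b \<in> verts ?H"
      using WV by blast
    then have "gdist ?H x ?b = 1 \<longleftrightarrow> i \<in> S" "gdist ?H y ?b = 1 \<longleftrightarrow> i \<in> T"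
      using xy(1,2) ST by (simp_all add: gdist_eq_1_iff edge_AV_BV_H_graph)
    then show ?thesis
      using i(2) b by metis
  qed
qed

lemma metric_dim_H_graph: "metric_dim (H_graph k) = k + 1"
  unfolding metric_dim_def
proof (rule Least_equality)
  let ?W = "insert (Inr ()) (Inl ` BV ` {1..k}) :: (fvertex + unit) set"
  have "card (Inl ` BV ` {1..k} :: (fvertex + unit) set) = k"
    by (simp add: card_image inj_on_def)
  then have "card ?W = k + 1"
    by (subst card_insert_disjoint) auto
  then show "\<exists>W. finite W \<and> metric_generator (H_graph k) W \<and> card W = k + 1"
    using metric_generator_H_graph by (intro exI[of _ ?W]) simp
next
  fix m
  assume "\<exists>W. finite W \<and> metric_generator (H_graph k) W \<and> card W = m"
  then obtain W where W: "metric_generator (H_graph k) W" "card W = m"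
    by blast
  have "finite (verts (H_graph k))"
    using simple_graph_H_graph unfolding simple_graph_def by blast
  then have "k + 2 ^ k + 1 \<le> m + 2 ^ m"
    using metric_generator_card_bound[OF _ W(1)] W(2) card_verts_H_graph[of k]
      dominating_gdist_le_2[OF dominating_Inr_H_graph] by auto
  \<comment> \<open>By monotonicity, \<open>m \<le> k\<close> would contradict the counting bound,
    whose left side exceeds \<open>k + 2 ^ k\<close> by one because of
    \<open>Inr ()\<close>.\<close>
  moreover have "m + 2 ^ m \<le> k + 2 ^ k" if "m \<le> k"
    using that by (intro add_mono power_increasing) auto
  ultimately show "k + 1 \<le> m"
    by (cases "m \<le> k") auto
qed

theorem theorem3p9:
  fixes k :: nat
  assumes "k \<ge> 1"
  shows "metric_dim (H_graph k) = k + 1 \<and>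
    edge_metric_dim (H_graph k) = k + 2 ^ k \<and>
    k + 2 ^ k = card (verts (H_graph k)) - 1 \<and>
    card (verts (H_graph k)) = k + 2 ^ k + 1"
proof -
  \<comment> \<open>Together with \<open>k \<ge> 1\<close> this yields the three vertices that the
    edge dimension lemma requires.\<close>
  have "(2::nat) ^ k \<ge> 1"
    by simp
  then have "card (verts (H_graph k)) \<ge> 3"
    unfolding card_verts_H_graph using assms by linarith
  then have "edge_metric_dim (H_graph k) = card (verts (H_graph k)) - 1"
    using edge_metric_dim_two_dominating[OF simple_graph_H_graph
      dominating_Inr_H_graph dominating_AV_H_graph] by simp
  then show ?thesis
    by (simp add: metric_dim_H_graph card_verts_H_graph)
qed

end
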